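(* Let $\{r,s,t\}=\{1,2,3\}$, let $F=(f_1,f_2,f_3):\Omega\subset\mathbb R^3\to\mathbb R^3$ be differentiable in the sense of Fréchet over an open set $\Omega$, and let $\mathbb A=\mathbb A^3_r(p_1,\dots,p_6)$. Then the components of $F$ satisfy on $\Omega$ the equations $$\begin{array}{ll} \frac{\partial f_r}{\partial x_s}=p_7\frac{\partial f_s}{\partial x_r}+p_8\frac{\partial f_t}{\partial x_r},&\frac{\partial f_r}{\partial x_t}=p_8\frac{\partial f_s}{\partial x_r}+p_9\frac{\partial f_t}{\partial x_r},\\[4pt] \frac{\partial f_s}{\partial x_s}=\frac{\partial f_r}{\partial x_r}+p_1\frac{\partial f_s}{\partial x_r}+p_3\frac{\partial f_t}{\partial x_r},&\frac{\partial f_s}{\partial x_t}=p_3\frac{\partial f_s}{\partial x_r}+p_5\frac{\partial f_t}{\partial x_r},\\[4pt] \frac{\partial f_t}{\partial x_s}=p_2\frac{\partial f_s}{\partial x_r}+p_4\frac{\partial f_t}{\partial x_r},&\frac{\partial f_t}{\partial x_t}=\frac{\partial f_r}{\partial x_r}+p_4\frac{\partial f_s}{\partial x_r}+p_6\frac{\partial f_t}{\partial x_r} \end{array}$$ if and only if $F$ is $\mathbb A$-algebrizable.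
   Context: For real $p_1,\dots,p_6$, set $p_7=p_2p_3+p_4^2-p_1p_4-p_2p_6$, $p_8=p_2p_5-p_3p_4$, $p_9=p_3^2+p_4p_5-p_1p_5-p_3p_6$. $\mathbb A^3_r(p_1,\dots,p_6)$ denotes $\mathbb R^3$ (canonical basis $e_1,e_2,e_3$) with the commutative associative product having unit $e=e_r$ and $e_se_s=p_7e_r+p_1e_s+p_2e_t$, $e_se_t=p_8e_r+p_3e_s+p_4e_t$, $e_te_t=p_9e_r+p_5e_s+p_6e_t$. $F$ is $\mathbb A$-algebrizable on $\Omega$ if there is a function $F':\Omega\to\mathbb R^3$ with $\lim_{\xi\to0}|F(w+\xi)-F(w)-F'(w)\xi|/|\xi|=0$ for all $w\in\Omega$, where $F'(w)\xi$ is the product in $\mathbb A$. *)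

theory Defs
  imports "HOL-Analysis.Analysis"
begin

definition coeff7 :: "real \<Rightarrow> real \<Rightarrow> real \<Rightarrow> real \<Rightarrow> real \<Rightarrow> real \<Rightarrow> real" where
  "coeff7 p1 p2 p3 p4 p5 p6 = p2 * p3 + p4^2 - p1 * p4 - p2 * p6"

definition coeff8 :: "real \<Rightarrow> real \<Rightarrow> real \<Rightarrow> real \<Rightarrow> real \<Rightarrow> real \<Rightarrow> real" where
  "coeff8 p1 p2 p3 p4 p5 p6 = p2 * p5 - p3 * p4"

definition coeff9 :: "real \<Rightarrow> real \<Rightarrow> real \<Rightarrow> real \<Rightarrow> real \<Rightarrow> real \<Rightarrow> real" where
  "coeff9 p1 p2 p3 p4 p5 p6 = p3^2 + p4 * p5 - p1 * p5 - p3 * p6"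

abbreviation basis_vec :: "3 \<Rightarrow> real^3" where
  "basis_vec i \<equiv> axis i 1"

(* The multiplication table on basis vectors; e_r is the unit. Only meaningful when r, s, t are
   the three distinct indices of type 3, the last branch then covering {i, j} = {s, t}. *)
definition basis_prod ::
  "3 \<Rightarrow> 3 \<Rightarrow> 3 \<Rightarrow> real \<Rightarrow> real \<Rightarrow> real \<Rightarrow> real \<Rightarrow> real \<Rightarrow> real \<Rightarrow> 3 \<Rightarrow> 3 \<Rightarrow> real^3" where
  "basis_prod r s t p1 p2 p3 p4 p5 p6 i j =
    (if i = r then basis_vec j
     else if j = r then basis_vec i
     else if i = s \<and> j = s then
       coeff7 p1 p2 p3 p4 p5 p6 *\<^sub>R basis_vec r + p1 *\<^sub>R basis_vec s + p2 *\<^sub>R basis_vec t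
     else if i = t \<and> j = t then
       coeff9 p1 p2 p3 p4 p5 p6 *\<^sub>R basis_vec r + p5 *\<^sub>R basis_vec s + p6 *\<^sub>R basis_vec t
     else
       coeff8 p1 p2 p3 p4 p5 p6 *\<^sub>R basis_vec r + p3 *\<^sub>R basis_vec s + p4 *\<^sub>R basis_vec t)"

definition alg_mult ::
  "3 \<Rightarrow> 3 \<Rightarrow> 3 \<Rightarrow> real \<Rightarrow> real \<Rightarrow> real \<Rightarrow> real \<Rightarrow> real \<Rightarrow> real \<Rightarrow> real^3 \<Rightarrow> real^3 \<Rightarrow> real^3" where
  "alg_mult r s t p1 p2 p3 p4 p5 p6 x y =
    (\<Sum>i\<in>UNIV. \<Sum>j\<in>UNIV. (x $ i * y $ j) *\<^sub>R basis_prod r s t p1 p2 p3 p4 p5 p6 i j)"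

(* Stated for an arbitrary product m on R^3, to be used with m = alg_mult r s t p1 ... p6.
   Only the values of F' on Omega matter. *)
definition algebrizable_on :: "(real^3 \<Rightarrow> real^3 \<Rightarrow> real^3) \<Rightarrow> (real^3 \<Rightarrow> real^3) \<Rightarrow> (real^3) set \<Rightarrow> bool" where
  "algebrizable_on m F \<Omega> \<longleftrightarrow>
    (\<exists>F' :: real^3 \<Rightarrow> real^3. \<forall>w\<in>\<Omega>.
      ((\<lambda>\<xi>. norm (F (w + \<xi>) - F w - m (F' w) \<xi>) / norm \<xi>) \<longlongrightarrow> 0) (at 0))"

(* The partial derivative of the i-th component of F with respect to the j-th variable at w. *)
definition partial_deriv :: "(real^3 \<Rightarrow> real^3) \<Rightarrow> 3 \<Rightarrow> 3 \<Rightarrow> real^3 \<Rightarrow> real" where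
  "partial_deriv F i j w = deriv (\<lambda>h. F (w + h *\<^sub>R basis_vec j) $ i) 0"

lemma alg_mult_basis:
  "alg_mult r s t p1 p2 p3 p4 p5 p6 (basis_vec i) (basis_vec j) = basis_prod r s t p1 p2 p3 p4 p5 p6 i j"
proof -
  have "(axis i 1 :: real^3) $ k * (axis j 1 :: real^3) $ l = (if k = i then if l = j then 1 else 0 else 0)" for k l
    by (simp add: axis_def)
  moreover have "(\<Sum>l\<in>UNIV. (if k = i then if l = j then 1 else 0 else 0) *\<^sub>R B l) = (if k = i then B j else 0)"
    for k and B :: "3 \<Rightarrow> real^3"
    by (simp add: if_distrib[of "\<lambda>a. a *\<^sub>R _"] cong: if_cong)
  ultimately show ?thesis
    unfolding alg_mult_def by simp
qed

lemma bilinear_alg_mult: "bilinear (alg_mult r s t p1 p2 p3 p4 p5 p6)"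
  unfolding bilinear_def alg_mult_def
  by (auto intro!: linearI simp: algebra_simps sum.distrib scaleR_sum_right)

lemma distinct_indices:
  fixes r s t :: 3
  assumes "{r, s, t} = {1, 2, 3}"
  shows "r \<noteq> s" "r \<noteq> t" "s \<noteq> t" "UNIV = {r, s, t}"
proof -
  show U: "UNIV = {r, s, t}" using assms UNIV_3 by simp
  have c: "card {r, s, t} = 3" using U[symmetric] by simp
  have le2: "card {a, b} \<le> 2" for a b :: 3 by (simp add: card_insert_if)
  show "r \<noteq> s" using c le2[of s t] by auto
  show "r \<noteq> t" using c le2[of s t] by (auto simp: insert_commute)
  show "s \<noteq> t" using c le2[of r t] by auto
qed

lemma alg_mult_components:
  fixes r s t :: 3 and p1 p2 p3 p4 p5 p6 :: real
  assumes "{r, s, t} = {1, 2, 3}"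
  defines "p7 \<equiv> coeff7 p1 p2 p3 p4 p5 p6" and "p8 \<equiv> coeff8 p1 p2 p3 p4 p5 p6"
    and "p9 \<equiv> coeff9 p1 p2 p3 p4 p5 p6"
  shows "alg_mult r s t p1 p2 p3 p4 p5 p6 x y $ r =
      x $ r * y $ r + p7 * (x $ s * y $ s) + p8 * (x $ s * y $ t + x $ t * y $ s) + p9 * (x $ t * y $ t)"
    and "alg_mult r s t p1 p2 p3 p4 p5 p6 x y $ s =
      x $ r * y $ s + x $ s * y $ r + p1 * (x $ s * y $ s) + p3 * (x $ s * y $ t + x $ t * y $ s) + p5 * (x $ t * y $ t)"
    and "alg_mult r s t p1 p2 p3 p4 p5 p6 x y $ t =
      x $ r * y $ t + x $ t * y $ r + p2 * (x $ s * y $ s) + p4 * (x $ s * y $ t + x $ t * y $ s) + p6 * (x $ t * y $ t)"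
  unfolding alg_mult_def distinct_indices(4)[OF assms(1)] p7_def p8_def p9_def
  using distinct_indices(1-3)[OF assms(1)] distinct_indices(1-3)[OF assms(1), symmetric]
  by (simp_all add: basis_prod_def axis_def algebra_simps)

lemma vec3_eqI:
  fixes r s t :: 3 and x y :: "real^3"
  assumes "{r, s, t} = {1, 2, 3}" "x $ r = y $ r" "x $ s = y $ s" "x $ t = y $ t"
  shows "x = y"
proof -
  have "x $ i = y $ i" for i
  proof -
    have "i \<in> {r, s, t}" unfolding distinct_indices(4)[OF assms(1), symmetric] by (rule UNIV_I)
    then consider "i = r" | "i = s" | "i = t" by blast
    then show ?thesis by cases (simp_all only: assms(2-4))
  qed
  then show ?thesis unfolding vec_eq_iff by (rule allI)
qed

lemma alg_mult_commute:
  assumes "{r, s, t} = {1, 2, 3}"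
  shows "alg_mult r s t p1 p2 p3 p4 p5 p6 x y = alg_mult r s t p1 p2 p3 p4 p5 p6 y x"
  by (rule vec3_eqI[OF assms]) (simp_all add: alg_mult_components[OF assms] algebra_simps)

lemma alg_mult_unit:
  assumes "{r, s, t} = {1, 2, 3}"
  shows "alg_mult r s t p1 p2 p3 p4 p5 p6 (basis_vec r) x = x"
  using distinct_indices(1-3)[OF assms]
  by (intro vec3_eqI[OF assms]) (simp_all add: alg_mult_components[OF assms] axis_def)

lemma alg_mult_assoc:
  assumes "{r, s, t} = {1, 2, 3}"
  shows "alg_mult r s t p1 p2 p3 p4 p5 p6 (alg_mult r s t p1 p2 p3 p4 p5 p6 x y) z =
    alg_mult r s t p1 p2 p3 p4 p5 p6 x (alg_mult r s t p1 p2 p3 p4 p5 p6 y z)"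
  by (rule vec3_eqI[OF assms];
    simp only: alg_mult_components[OF assms] coeff7_def coeff8_def coeff9_def;
    simp add: algebra_simps power2_eq_square)

end

theory Submission imports Defs begin

text \<open>
  The limit defining algebrizability at a point is the limit defining the Frechet derivative, with
  the linear map \<open>m (F' w)\<close> in the place of the derivative. By uniqueness of the derivative,
  a differentiable \<open>F\<close> is therefore algebrizable exactly when each of its derivatives \<open>D\<close> is
  a multiplication map \<open>m u\<close> (\<open>algebrizable_on_iff_derivative_is_multiplication\<close>). Evaluation at
  the unit \<open>e\<^sub>r\<close> leaves only one candidate, \<open>u = D e\<^sub>r\<close>. Two linear maps that already agree at
  \<open>e\<^sub>r\<close> are equal when they agree at \<open>e\<^sub>s\<close> and \<open>e\<^sub>t\<close>, and the three components of these two vector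
  equations are the six generalized Cauchy-Riemann equations
  (\<open>multiplication_map_iff_cauchy_riemann\<close>), the entries \<open>D e\<^sub>j $ i\<close> being the partial derivatives.
\<close>

lemma partial_deriv_eq_derivative_entry:
  assumes "(F has_derivative D) (at w)"
  shows "partial_deriv F i j w = D (basis_vec j) $ i"
proof -
  have lin: "linear D"
    using assms by (rule has_derivative_linear)
  have "((\<lambda>h::real. w + h *\<^sub>R basis_vec j) has_derivative (\<lambda>h. h *\<^sub>R basis_vec j)) (at 0)"
    by (auto intro!: derivative_eq_intros)
  moreover have "(F has_derivative D) (at (w + (0::real) *\<^sub>R basis_vec j))"
    using assms by simp
  ultimately have "((\<lambda>h. F (w + h *\<^sub>R basis_vec j)) has_derivative (\<lambda>h. D (h *\<^sub>R basis_vec j))) (at 0)"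
    by (rule has_derivative_compose)
  from bounded_linear.has_derivative[OF bounded_linear_vec_nth this]
  have "((\<lambda>h. F (w + h *\<^sub>R basis_vec j) $ i) has_derivative (\<lambda>h. D (h *\<^sub>R basis_vec j) $ i)) (at 0)" .
  moreover have "(\<lambda>h. D (h *\<^sub>R basis_vec j) $ i) = (*) (D (basis_vec j) $ i)"
    by (simp add: linear_cmul[OF lin] fun_eq_iff)
  ultimately have "((\<lambda>h. F (w + h *\<^sub>R basis_vec j) $ i) has_field_derivative D (basis_vec j) $ i) (at 0)"
    by (simp add: has_field_derivative_def)
  then show ?thesis
    unfolding partial_deriv_def by (rule DERIV_imp_deriv)
qed

text \<open>
  Each \<open>m u\<close> is linear on a finite-dimensional space, hence bounded, so the limit in the definition
  of algebrizability says that \<open>m (F' w)\<close> is the derivative.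
\<close>
lemma algebrizable_on_iff_derivative_is_multiplication:
  assumes m: "bilinear m" and D: "\<And>w. w \<in> \<Omega> \<Longrightarrow> (F has_derivative D w) (at w)"
  shows "algebrizable_on m F \<Omega> \<longleftrightarrow> (\<forall>w\<in>\<Omega>. \<exists>u. D w = m u)"
proof -
  have "bounded_linear (m u)" for u
    using m by (simp add: bilinear_def linear_conv_bounded_linear)
  then have "algebrizable_on m F \<Omega> \<longleftrightarrow> (\<exists>F'. \<forall>w\<in>\<Omega>. (F has_derivative m (F' w)) (at w))"
    unfolding algebrizable_on_def has_derivative_at by simp
  also have "\<dots> \<longleftrightarrow> (\<exists>F'. \<forall>w\<in>\<Omega>. D w = m (F' w))"
    using D has_derivative_unique by metis
  also have "\<dots> \<longleftrightarrow> (\<forall>w\<in>\<Omega>. \<exists>u. D w = m u)"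
    by metis
  finally show ?thesis .
qed

text \<open>
  The left-hand side forces \<open>u = D e\<^sub>r\<close>, since \<open>e\<^sub>r\<close> is the unit. With this \<open>u\<close> the two maps agree
  at \<open>e\<^sub>r\<close>; the six equations compare their components at \<open>e\<^sub>s\<close> and \<open>e\<^sub>t\<close>.
\<close>
lemma multiplication_map_iff_cauchy_riemann:
  fixes r s t :: 3 and p1 p2 p3 p4 p5 p6 :: real and D :: "real^3 \<Rightarrow> real^3"
  assumes rst: "{r, s, t} = {1, 2, 3}" and D: "linear D"
  defines "p7 \<equiv> coeff7 p1 p2 p3 p4 p5 p6" and "p8 \<equiv> coeff8 p1 p2 p3 p4 p5 p6"
    and "p9 \<equiv> coeff9 p1 p2 p3 p4 p5 p6"
    and "d \<equiv> \<lambda>i j. D (basis_vec j) $ i"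
  shows "(\<exists>u. D = alg_mult r s t p1 p2 p3 p4 p5 p6 u) \<longleftrightarrow>
      d r s = p7 * d s r + p8 * d t r \<and>
      d r t = p8 * d s r + p9 * d t r \<and>
      d s s = d r r + p1 * d s r + p3 * d t r \<and>
      d s t = p3 * d s r + p5 * d t r \<and>
      d t s = p2 * d s r + p4 * d t r \<and>
      d t t = d r r + p4 * d s r + p6 * d t r"
proof -
  let ?m = "alg_mult r s t p1 p2 p3 p4 p5 p6"
  let ?u = "D (basis_vec r)"
  note dist = distinct_indices(1-3)[OF rst]
  have unit: "?m u (basis_vec r) = u" for u
    by (subst alg_mult_commute[OF rst]) (rule alg_mult_unit[OF rst])
  have all_iff: "(\<forall>i. P i) \<longleftrightarrow> P r \<and> P s \<and> P t" for P
  proof -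
    have "(\<forall>i\<in>UNIV. P i) \<longleftrightarrow> P r \<and> P s \<and> P t"
      unfolding distinct_indices(4)[OF rst] by simp
    then show ?thesis by simp
  qed
  have "(\<exists>u. D = ?m u) \<longleftrightarrow> D = ?m ?u"
    using unit by metis
  also have "\<dots> \<longleftrightarrow> (\<forall>j. D (basis_vec j) = ?m ?u (basis_vec j))"
  proof
    assume agree: "\<forall>j. D (basis_vec j) = ?m ?u (basis_vec j)"
    have "linear (?m ?u)"
      using bilinear_alg_mult by (simp add: bilinear_def)
    moreover have "D b = ?m ?u b" if "b \<in> Basis" for b
    proof -
      from that obtain j where "b = basis_vec j"
        by (auto simp: Basis_vec_def)
      with agree show ?thesis by blast
    qed
    ultimately show "D = ?m ?u"
      using D linear_eq_stdbasis by blast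
  qed metis
  also have "\<dots> \<longleftrightarrow>
      D (basis_vec s) = ?m ?u (basis_vec s) \<and> D (basis_vec t) = ?m ?u (basis_vec t)"
    by (subst all_iff) (simp add: unit)
  also have "\<dots> \<longleftrightarrow>
      (d r s = p7 * d s r + p8 * d t r \<and> d s s = d r r + p1 * d s r + p3 * d t r \<and>
       d t s = p2 * d s r + p4 * d t r) \<and>
      (d r t = p8 * d s r + p9 * d t r \<and> d s t = p3 * d s r + p5 * d t r \<and>
       d t t = d r r + p4 * d s r + p6 * d t r)"
    unfolding vec_eq_iff all_iff alg_mult_components[OF rst] d_def p7_def p8_def p9_def
    using dist dist[symmetric] by (simp add: axis_def)
  finally show ?thesis by blast
qed

theorem theorem2p3:
  fixes r s t :: 3
    and p1 p2 p3 p4 p5 p6 p7 p8 p9 :: real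
    and F :: "real^3 \<Rightarrow> real^3"
    and \<Omega> :: "(real^3) set"
  assumes "{r, s, t} = {1, 2, 3}"
    and "p7 = coeff7 p1 p2 p3 p4 p5 p6"
    and "p8 = coeff8 p1 p2 p3 p4 p5 p6"
    and "p9 = coeff9 p1 p2 p3 p4 p5 p6"
    and "open \<Omega>"
    and "\<forall>w\<in>\<Omega>. F differentiable (at w)"
  shows "(\<forall>w\<in>\<Omega>.
      partial_deriv F r s w = p7 * partial_deriv F s r w + p8 * partial_deriv F t r w \<and>
      partial_deriv F r t w = p8 * partial_deriv F s r w + p9 * partial_deriv F t r w \<and>
      partial_deriv F s s w = partial_deriv F r r w + p1 * partial_deriv F s r w + p3 * partial_deriv F t r w \<and>
      partial_deriv F s t w = p3 * partial_deriv F s r w + p5 * partial_deriv F t r w \<and>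
      partial_deriv F t s w = p2 * partial_deriv F s r w + p4 * partial_deriv F t r w \<and>
      partial_deriv F t t w = partial_deriv F r r w + p4 * partial_deriv F s r w + p6 * partial_deriv F t r w)
    \<longleftrightarrow> algebrizable_on (alg_mult r s t p1 p2 p3 p4 p5 p6) F \<Omega>"
proof -
  define D where "D w = frechet_derivative F (at w)" for w
  have D: "(F has_derivative D w) (at w)" if "w \<in> \<Omega>" for w
    using assms(6) that by (simp add: D_def frechet_derivative_works[symmetric])
  have "algebrizable_on (alg_mult r s t p1 p2 p3 p4 p5 p6) F \<Omega> \<longleftrightarrow>
      (\<forall>w\<in>\<Omega>. \<exists>u. D w = alg_mult r s t p1 p2 p3 p4 p5 p6 u)"
    using bilinear_alg_mult D by (rule algebrizable_on_iff_derivative_is_multiplication)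
  then show ?thesis
    using multiplication_map_iff_cauchy_riemann[OF assms(1) has_derivative_linear[OF D]]
    by (simp add: partial_deriv_eq_derivative_entry[OF D] assms(2-4))
qed

end
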